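(* Let points $M_1,\dots,M_N\in\mathbb R^k$ with masses $m_1,\dots,m_N>0$ be given, not all contained in one hyperplane, with total mass $m$, center of masses $C$ and central principal hyperplanar moments of inertia $0<J_1<\dots<J_k$. Use Cartesian coordinates with origin $C$ along the principal axes at $C$, and consider the pencil of confocal quadrics with parameter $\mu$ $$\frac{x_1^2}{\mu-J_1}+\frac{x_2^2}{\mu-J_2}+\dots+\frac{x_k^2}{\mu-J_k}=\frac1m .$$ For any point $P=(x_{01},\dots,x_{0k})$ there are $k$ mutually orthogonal quadrics from this confocal pencil that contain $P$. The $k$ tangent hyperplanes to these quadrics at $P$ are the principal hyperplanes of inertia at $P$. The obtained principal coordinate axes at $P$ are the principal components solving Restricted PCA restricted at $P$, i.e. providing the maximum variance among the normalized combinations $n^TX_P$, uncorrelated with the previous ones.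
   Context: Central principal moments: $J_1,\dots,J_k$ are the eigenvalues of the central hyperplanar operator of inertia $J_C$ (the operator $J_P$ below with $P=C$), and the principal axes at $C$ are its orthonormal eigenvectors (the $x_i$-axis corresponds to $J_i$). The hyperplanar operator of inertia at a point $P$ is the symmetric operator with $\langle J_P\mathbf n_1,\mathbf n_2\rangle=\sum_{j=1}^N m_j\langle\mathbf r_j,\mathbf n_1\rangle\langle\mathbf r_j,\mathbf n_2\rangle$, $\mathbf r_j=M_j-P$. The principal axes at $P$ are the lines through $P$ in the directions of the eigenvectors of $J_P$, and the principal hyperplanes of inertia at $P$ are the hyperplanes through $P$ orthogonal to eigenvectors of $J_P$. $X_P$ is the $k\times N$ matrix whose $j$-th column is $\sqrt{m_j}\,(M_j-P)$, so $J_P=X_PX_P^T$. For a unit vector $n$, the variance of $n^TX_P$ is $n^TJ_Pn$; $n^TX_P$ and $n'^TX_P$ are uncorrelated if $n^TJ_Pn'=0$. Restricted PCA at $P$: find successively unit vectors $n_1,n_2,\dots,n_k$ such that $n_j$ maximizes $n^TJ_Pn$ among unit vectors $n$ for which $n^TX_P$ is uncorrelated with $n_1^TX_P,\dots,n_{j-1}^TX_P$. Degenerate members: for $\mu=J_i$ the member of the pencil is the coordinate hyperplane $x_i=0$ (which is its own tangent hyperplane). Quadrics containing $P$ are mutually orthogonal if their tangent hyperplanes at $P$ are mutually orthogonal.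
   Formalization: At focal points (x_i=0 and sum over l≠i of x_l²/(J_i−J_l)=1/m for some i) fewer than k distinct quadrics contain P; there the k are counted with multiplicity and their tangent hyperplanes are principal but not all principal hyperplanes. The PCA claim is kept for all P. *)

theory Defs
  imports "HOL-Analysis.Analysis"
begin

text \<open>Points \<open>M j\<close> with masses \<open>m j\<close>, indexed by a finite type \<open>'N\<close>, in \<open>real ^ 'k\<close>; the
  dimension is \<open>CARD('k)\<close>. Coordinates, principal moments and principal components are indexed
  by the natural numbers \<open>1, \<dots>, CARD('k)\<close>, since their order matters.\<close>

definition total_mass :: "('N::finite \<Rightarrow> real) \<Rightarrow> real" where
  "total_mass m = (\<Sum>j\<in>UNIV. m j)"

definition center_of_mass :: "('N::finite \<Rightarrow> real ^ 'k) \<Rightarrow> ('N \<Rightarrow> real) \<Rightarrow> real ^ 'k" where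
  "center_of_mass M m = (1 / total_mass m) *\<^sub>R (\<Sum>j\<in>UNIV. m j *\<^sub>R M j)"

definition inertia_op ::
  "('N::finite \<Rightarrow> real ^ 'k) \<Rightarrow> ('N \<Rightarrow> real) \<Rightarrow> real ^ 'k \<Rightarrow> real ^ 'k \<Rightarrow> real ^ 'k" where
  "inertia_op M m P v = (\<Sum>j\<in>UNIV. (m j * ((M j - P) \<bullet> v)) *\<^sub>R (M j - P))"

lemma inertia_op_inner:
  "inertia_op M m P v \<bullet> w = (\<Sum>j\<in>UNIV. m j * ((M j - P) \<bullet> v) * ((M j - P) \<bullet> w))"
  by (simp add: inertia_op_def inner_sum_left)

lemma inertia_op_symmetric: "inertia_op M m P v \<bullet> w = v \<bullet> inertia_op M m P w"
  by (simp add: inertia_op_inner inner_commute[of v] mult.commute mult.left_commute)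

lemma linear_inertia_op: "linear (inertia_op M m P)"
  by (rule linearI)
    (simp_all add: inertia_op_def inner_add_right distrib_left scaleR_add_left sum.distrib
      scaleR_sum_right mult.left_commute)

definition data_matrix ::
  "('N::finite \<Rightarrow> real ^ 'k) \<Rightarrow> ('N \<Rightarrow> real) \<Rightarrow> real ^ 'k \<Rightarrow> real ^ 'N ^ 'k" where
  "data_matrix M m P = (\<chi> i j. sqrt (m j) * (M j - P) $ i)"

definition covariance ::
  "('N::finite \<Rightarrow> real ^ 'k) \<Rightarrow> ('N \<Rightarrow> real) \<Rightarrow> real ^ 'k \<Rightarrow> real ^ 'k \<Rightarrow> real ^ 'k \<Rightarrow> real" where
  "covariance M m P v w = v \<bullet> inertia_op M m P w"

lemma vector_matrix_data_matrix:
  "(v v* data_matrix M m P) $ j = sqrt (m j) * ((M j - P) \<bullet> v)"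
  by (simp add: vector_matrix_mult_def data_matrix_def inner_vec_def sum_distrib_left mult_ac)

lemma covariance_data_matrix:
  assumes "\<And>j. m j > 0"
  shows "covariance M m P v w = (v v* data_matrix M m P) \<bullet> (w v* data_matrix M m P)"
proof -
  have "(v v* data_matrix M m P) \<bullet> (w v* data_matrix M m P)
      = (\<Sum>j\<in>UNIV. (sqrt (m j) * ((M j - P) \<bullet> v)) * (sqrt (m j) * ((M j - P) \<bullet> w)))"
    by (simp add: inner_vec_def[of "_ v* _"] vector_matrix_data_matrix)
  also have "\<dots> = (\<Sum>j\<in>UNIV. (sqrt (m j))\<^sup>2 * ((M j - P) \<bullet> v) * ((M j - P) \<bullet> w))"
    by (intro sum.cong refl) (simp only: power2_eq_square mult_ac)
  also have "\<dots> = covariance M m P v w"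
    by (simp only: real_sqrt_pow2[OF less_imp_le[OF assms]] covariance_def
        inertia_op_symmetric[symmetric] inertia_op_inner)
  finally show ?thesis by simp
qed

lemma inertia_op_data_matrix:
  assumes "\<And>j. m j > 0"
  shows "inertia_op M m P v = (data_matrix M m P ** transpose (data_matrix M m P)) *v v"
proof -
  have "w \<bullet> inertia_op M m P v = w \<bullet> ((data_matrix M m P ** transpose (data_matrix M m P)) *v v)" for w
    using covariance_data_matrix[where M = M and P = P and v = w and w = v, OF assms]
    by (simp add: covariance_def dot_lmul_matrix flip: matrix_vector_mul_assoc)
  then show ?thesis by (subst vector_eq_ldot[symmetric]) blast
qed

definition hyperplane_through :: "real ^ 'k \<Rightarrow> real ^ 'k \<Rightarrow> (real ^ 'k) set" where
  "hyperplane_through P v = {x. v \<bullet> (x - P) = 0}"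

definition line_through :: "real ^ 'k \<Rightarrow> real ^ 'k \<Rightarrow> (real ^ 'k) set" where
  "line_through P v = {P + t *\<^sub>R v | t. True}"

definition orthogonal_hyperplanes :: "(real ^ 'k) set \<Rightarrow> (real ^ 'k) set \<Rightarrow> bool" where
  "orthogonal_hyperplanes H H' \<longleftrightarrow>
    (\<exists>a b c d. a \<noteq> 0 \<and> b \<noteq> 0 \<and> H = {x. a \<bullet> x = c} \<and> H' = {x. b \<bullet> x = d} \<and> a \<bullet> b = 0)"

definition principal_direction ::
  "('N::finite \<Rightarrow> real ^ 'k) \<Rightarrow> ('N \<Rightarrow> real) \<Rightarrow> real ^ 'k \<Rightarrow> real ^ 'k \<Rightarrow> bool" where
  "principal_direction M m P v \<longleftrightarrow> v \<noteq> 0 \<and> (\<exists>l. inertia_op M m P v = l *\<^sub>R v)"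

definition principal_axes ::
  "('N::finite \<Rightarrow> real ^ 'k) \<Rightarrow> ('N \<Rightarrow> real) \<Rightarrow> real ^ 'k \<Rightarrow> (real ^ 'k) set set" where
  "principal_axes M m P = {line_through P v | v. principal_direction M m P v}"

definition principal_hyperplanes ::
  "('N::finite \<Rightarrow> real ^ 'k) \<Rightarrow> ('N \<Rightarrow> real) \<Rightarrow> real ^ 'k \<Rightarrow> (real ^ 'k) set set" where
  "principal_hyperplanes M m P = {hyperplane_through P v | v. principal_direction M m P v}"

text \<open>An orthonormal system of eigenvectors \<open>e i\<close> at the center of masses; since there are
  \<open>CARD('k)\<close> of them, the \<open>J i\<close> are all the eigenvalues.\<close>

definition central_principal_system ::
  "('N::finite \<Rightarrow> real ^ 'k) \<Rightarrow> ('N \<Rightarrow> real) \<Rightarrow> (nat \<Rightarrow> real ^ 'k) \<Rightarrow> (nat \<Rightarrow> real) \<Rightarrow> bool" where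
  "central_principal_system M m e J \<longleftrightarrow>
    (\<forall>i\<in>{1..CARD('k)}. \<forall>j\<in>{1..CARD('k)}. e i \<bullet> e j = (if i = j then 1 else 0)) \<and>
    (\<forall>i\<in>{1..CARD('k)}. inertia_op M m (center_of_mass M m) (e i) = J i *\<^sub>R e i)"

definition central_coord ::
  "('N::finite \<Rightarrow> real ^ 'k) \<Rightarrow> ('N \<Rightarrow> real) \<Rightarrow> (nat \<Rightarrow> real ^ 'k) \<Rightarrow> real ^ 'k \<Rightarrow> nat \<Rightarrow> real" where
  "central_coord M m e x i = e i \<bullet> (x - center_of_mass M m)"

text \<open>Defining function of the member of the pencil with parameter \<open>\<mu>\<close>; for \<open>\<mu> = J i\<close> the member
  is the coordinate hyperplane \<open>x\<^sub>i = 0\<close>. The description is used for \<open>J\<close> injective on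
  \<open>{1..CARD('k)}\<close>.\<close>

definition confocal_function ::
  "('N::finite \<Rightarrow> real ^ 'k) \<Rightarrow> ('N \<Rightarrow> real) \<Rightarrow> (nat \<Rightarrow> real ^ 'k) \<Rightarrow> (nat \<Rightarrow> real) \<Rightarrow>
    real \<Rightarrow> real ^ 'k \<Rightarrow> real" where
  "confocal_function M m e J \<mu> x =
    (if \<mu> \<in> J ` {1..CARD('k)}
     then central_coord M m e x (THE i. i \<in> {1..CARD('k)} \<and> J i = \<mu>)
     else (\<Sum>i=1..CARD('k). (central_coord M m e x i)\<^sup>2 / (\<mu> - J i)) - 1 / total_mass m)"

definition confocal_quadric ::
  "('N::finite \<Rightarrow> real ^ 'k) \<Rightarrow> ('N \<Rightarrow> real) \<Rightarrow> (nat \<Rightarrow> real ^ 'k) \<Rightarrow> (nat \<Rightarrow> real) \<Rightarrow>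
    real \<Rightarrow> (real ^ 'k) set" where
  "confocal_quadric M m e J \<mu> = {x. confocal_function M m e J \<mu> x = 0}"

definition confocal_tangent ::
  "('N::finite \<Rightarrow> real ^ 'k) \<Rightarrow> ('N \<Rightarrow> real) \<Rightarrow> (nat \<Rightarrow> real ^ 'k) \<Rightarrow> (nat \<Rightarrow> real) \<Rightarrow>
    real \<Rightarrow> real ^ 'k \<Rightarrow> (real ^ 'k) set" where
  "confocal_tangent M m e J \<mu> P =
    {x. frechet_derivative (confocal_function M m e J \<mu>) (at P) (x - P) = 0}"

definition confocal_params_at ::
  "('N::finite \<Rightarrow> real ^ 'k) \<Rightarrow> ('N \<Rightarrow> real) \<Rightarrow> (nat \<Rightarrow> real ^ 'k) \<Rightarrow> (nat \<Rightarrow> real) \<Rightarrow>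
    real ^ 'k \<Rightarrow> real set" where
  "confocal_params_at M m e J P = {\<mu>. P \<in> confocal_quadric M m e J \<mu>}"

definition confocal_quadrics_at ::
  "('N::finite \<Rightarrow> real ^ 'k) \<Rightarrow> ('N \<Rightarrow> real) \<Rightarrow> (nat \<Rightarrow> real ^ 'k) \<Rightarrow> (nat \<Rightarrow> real) \<Rightarrow>
    real ^ 'k \<Rightarrow> (real ^ 'k) set set" where
  "confocal_quadrics_at M m e J P = {Q \<in> range (confocal_quadric M m e J). P \<in> Q}"

text \<open>The indices \<open>i\<close> such that \<open>P\<close> lies on the focal quadric in the hyperplane \<open>x\<^sub>i = 0\<close>.
  There \<open>J i\<close> is a double root in \<open>\<mu>\<close> of
  \<open>\<Prod>\<^sub>l (\<mu> - J l) \<cdot> (1/m - \<Sum>\<^sub>l x\<^sub>l\<^sup>2 / (\<mu> - J l))\<close> with the denominators cleared,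
  so two of the \<open>k\<close> quadrics through nearby points coalesce in the single member \<open>x\<^sub>i = 0\<close>.\<close>

definition focal_indices ::
  "('N::finite \<Rightarrow> real ^ 'k) \<Rightarrow> ('N \<Rightarrow> real) \<Rightarrow> (nat \<Rightarrow> real ^ 'k) \<Rightarrow> (nat \<Rightarrow> real) \<Rightarrow>
    real ^ 'k \<Rightarrow> nat set" where
  "focal_indices M m e J P =
    {i \<in> {1..CARD('k)}. central_coord M m e P i = 0 \<and>
      (\<Sum>l\<in>{1..CARD('k)} - {i}. (central_coord M m e P l)\<^sup>2 / (J i - J l)) = 1 / total_mass m}"

definition restricted_pca ::
  "('N::finite \<Rightarrow> real ^ 'k) \<Rightarrow> ('N \<Rightarrow> real) \<Rightarrow> real ^ 'k \<Rightarrow> (nat \<Rightarrow> real ^ 'k) \<Rightarrow> bool" where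
  "restricted_pca M m P n \<longleftrightarrow>
    (\<forall>j\<in>{1..CARD('k)}.
      norm (n j) = 1 \<and> (\<forall>i\<in>{1..<j}. covariance M m P (n j) (n i) = 0) \<and>
      (\<forall>v. norm v = 1 \<and> (\<forall>i\<in>{1..<j}. covariance M m P v (n i) = 0) \<longrightarrow>
         covariance M m P v v \<le> covariance M m P (n j) (n j)))"

end

theory Submission
  imports Defs
begin

text \<open>
  Write \<open>A\<close> for the inertia operator at \<open>P\<close>, \<open>C\<close> for the center of masses and \<open>p = P - C\<close>. All
  claims are about the eigenvectors of \<open>A\<close>.

  The confocal quadrics enter through the parallel axis theorem (\<open>parallel_axis\<close>): \<open>A\<close> is the
  central operator plus the rank-one operator \<open>v \<mapsto> m (p \<bullet> v) p\<close>. In principal coordinates at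
  \<open>C\<close> the equation \<open>A v = \<mu> v\<close> reads \<open>(\<mu> - J\<^sub>i) v\<^sub>i = m (p \<bullet> v) p\<^sub>i\<close>. If \<open>\<mu>\<close> is none of the
  \<open>J\<^sub>i\<close>, then \<open>v\<close> is a multiple of the vector with coordinates \<open>p\<^sub>i / (\<mu> - J\<^sub>i)\<close>, and taking the
  inner product with \<open>p\<close> leaves the condition \<open>\<Sum>\<^sub>i p\<^sub>i\<^sup>2 / (\<mu> - J\<^sub>i) = 1 / m\<close>: the quadric with
  parameter \<open>\<mu>\<close> contains \<open>P\<close>, and \<open>v\<close> is normal to it at \<open>P\<close>. If \<open>\<mu> = J\<^sub>i\<close>, an eigenvector exists
  exactly when \<open>p\<^sub>i = 0\<close>, that is, when \<open>P\<close> lies in the degenerate member \<open>x\<^sub>i = 0\<close>, whose normal is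
  an eigenvector. So the parameters of the members through \<open>P\<close> are the eigenvalues of \<open>A\<close>
  (\<open>params_eq_eigenvalues\<close>), and tangent hyperplanes for different parameters are
  orthogonal because eigenspaces are. An eigenspace is a line, except that it has dimension two
  when \<open>P\<close> is on the focal quadric in \<open>x\<^sub>i = 0\<close> (\<open>eigenspace_nonfocal\<close>,
  \<open>dim_eigenspace_focal\<close>). Since the dimensions of the eigenspaces add up to that of the space,
  this counts the quadrics (\<open>card_params\<close>).

  For restricted PCA it only matters that \<open>A\<close> is self-adjoint and positive definite. A maximizer of
  \<open>v \<bullet> A v\<close> on the unit sphere of an invariant subspace is an eigenvector; positivity turns being
  uncorrelated with an eigenvector into being orthogonal to it, so that each step of the procedure
  takes place in an invariant subspace. Hence the solutions are exactly the orthonormal eigenbases with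
  nonincreasing eigenvalues (\<open>successive_maximizers_iff\<close>). They exist by compactness, which gives the
  spectral theorem used in the count.
\<close>

section \<open>Orthonormal families indexed by the dimension\<close>

text \<open>The range \<open>1, \<dots>, DIM('a)\<close> is part of the notion, so that such a family is a basis; the values of
  \<open>n\<close> elsewhere are arbitrary.\<close>

definition orthonormal_family :: "(nat \<Rightarrow> 'a::euclidean_space) \<Rightarrow> bool" where
  "orthonormal_family n \<longleftrightarrow>
    (\<forall>i\<in>{1..DIM('a)}. \<forall>j\<in>{1..DIM('a)}. n i \<bullet> n j = (if i = j then 1 else 0))"

lemma orthonormal_familyD:
  fixes n :: "nat \<Rightarrow> 'a::euclidean_space"
  assumes "orthonormal_family n" "i \<in> {1..DIM('a)}" "j \<in> {1..DIM('a)}"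
  shows "n i \<bullet> n j = (if i = j then 1 else 0)"
  using assms unfolding orthonormal_family_def by blast

lemma orthonormal_family_inj_on:
  fixes n :: "nat \<Rightarrow> 'a::euclidean_space"
  assumes "orthonormal_family n"
  shows "inj_on n {1..DIM('a)}"
proof (rule inj_onI)
  fix i j assume ij: "i \<in> {1..DIM('a)}" "j \<in> {1..DIM('a)}" "n i = n j"
  then show "i = j"
    using orthonormal_familyD[OF assms ij(1,1)] orthonormal_familyD[OF assms ij(1,2)]
    by (auto split: if_splits)
qed

lemma orthonormal_family_independent:
  fixes n :: "nat \<Rightarrow> 'a::euclidean_space"
  assumes "orthonormal_family n" "S \<subseteq> {1..DIM('a)}"
  shows "independent (n ` S)"
proof (rule pairwise_orthogonal_independent)
  show "pairwise orthogonal (n ` S)"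
    using assms by (auto simp: pairwise_def orthogonal_def orthonormal_family_def subset_iff)
  show "0 \<notin> n ` S"
    using orthonormal_familyD[OF assms(1)] assms(2) by (metis imageE inner_zero_left subsetD zero_neq_one)
qed

text \<open>There are as many members as the dimension, so they span the whole space and a vector
  is determined by its coordinates.\<close>

lemma orthonormal_family_eqI:
  fixes n :: "nat \<Rightarrow> 'a::euclidean_space"
  assumes n: "orthonormal_family n" and eq: "\<And>i. i \<in> {1..DIM('a)} \<Longrightarrow> n i \<bullet> v = n i \<bullet> w"
  shows "v = w"
proof -
  have "span (n ` {1..DIM('a)}) = UNIV"
    using card_ge_dim_independent[of "n ` {1..DIM('a)}" UNIV]
      orthonormal_family_independent[OF n order_refl] orthonormal_family_inj_on[OF n]
    by (auto simp: card_image)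
  moreover have "orthogonal (v - w) y" if "y \<in> n ` {1..DIM('a)}" for y
    using that eq by (auto simp: orthogonal_def inner_diff_left inner_commute[of _ "n _"])
  ultimately have "orthogonal (v - w) (v - w)"
    using orthogonal_to_span[of "v - w" "n ` {1..DIM('a)}" "v - w"] by auto
  then show ?thesis
    by (simp add: orthogonal_def)
qed

lemma inner_sum_orthonormal_family:
  fixes n :: "nat \<Rightarrow> 'a::euclidean_space"
  assumes "orthonormal_family n" "i \<in> {1..DIM('a)}"
  shows "n i \<bullet> (\<Sum>l\<in>{1..DIM('a)}. c l *\<^sub>R n l) = c i"
proof -
  have "n i \<bullet> (\<Sum>l\<in>{1..DIM('a)}. c l *\<^sub>R n l) = (\<Sum>l\<in>{1..DIM('a)}. if l = i then c l else 0)"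
    unfolding inner_sum_right
    by (intro sum.cong refl) (simp add: orthonormal_familyD[OF assms(1) assms(2)])
  then show ?thesis using assms(2) by simp
qed

lemma orthonormal_expansion:
  fixes n :: "nat \<Rightarrow> 'a::euclidean_space"
  assumes "orthonormal_family n"
  shows "v = (\<Sum>l\<in>{1..DIM('a)}. (n l \<bullet> v) *\<^sub>R n l)"
  by (rule orthonormal_family_eqI[OF assms]) (simp only: inner_sum_orthonormal_family[OF assms])

lemma inner_orthonormal_expansion:
  fixes n :: "nat \<Rightarrow> 'a::euclidean_space"
  assumes "orthonormal_family n"
  shows "v \<bullet> w = (\<Sum>l\<in>{1..DIM('a)}. (n l \<bullet> v) * (n l \<bullet> w))"
proof -
  have "v \<bullet> w = (\<Sum>l\<in>{1..DIM('a)}. (n l \<bullet> v) *\<^sub>R n l) \<bullet> w"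
    using orthonormal_expansion[OF assms, of v] by simp
  then show ?thesis by (simp add: inner_sum_left)
qed

section \<open>Successive maximization of a positive definite quadratic form\<close>

locale positive_operator =
  fixes A :: "'a::euclidean_space \<Rightarrow> 'a"
  assumes linear: "linear A"
    and self_adjoint: "A v \<bullet> w = v \<bullet> A w"
    and positive: "v \<noteq> 0 \<Longrightarrow> 0 < v \<bullet> A v"
begin

definition eigenspace :: "real \<Rightarrow> 'a set" where
  "eigenspace l = {v. A v = l *\<^sub>R v}"

definition eigenvalues :: "real set" where
  "eigenvalues = {l. \<exists>v\<in>eigenspace l. v \<noteq> 0}"

text \<open>For a unit eigenvector \<open>v\<close> the eigenvalue is \<open>v \<bullet> A v\<close>; using this expression spares a
  separate family of eigenvalues and makes the ordering one of variances.\<close>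

definition ordered_eigenbasis :: "(nat \<Rightarrow> 'a) \<Rightarrow> bool" where
  "ordered_eigenbasis n \<longleftrightarrow> orthonormal_family n \<and>
    (\<forall>j\<in>{1..DIM('a)}. A (n j) = (n j \<bullet> A (n j)) *\<^sub>R n j) \<and>
    (\<forall>i\<in>{1..DIM('a)}. \<forall>j\<in>{1..DIM('a)}. i \<le> j \<longrightarrow> n j \<bullet> A (n j) \<le> n i \<bullet> A (n i))"

text \<open>Restricted PCA with the covariance form \<open>v \<bullet> A w\<close> of an arbitrary positive definite operator.\<close>

definition successive_maximizers :: "(nat \<Rightarrow> 'a) \<Rightarrow> bool" where
  "successive_maximizers n \<longleftrightarrow>
    (\<forall>j\<in>{1..DIM('a)}.
      norm (n j) = 1 \<and> (\<forall>i\<in>{1..<j}. n j \<bullet> A (n i) = 0) \<and>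
      (\<forall>v. norm v = 1 \<and> (\<forall>i\<in>{1..<j}. v \<bullet> A (n i) = 0) \<longrightarrow> v \<bullet> A v \<le> n j \<bullet> A (n j)))"

lemma eigenspace_orthogonal:
  assumes "v \<in> eigenspace l" "w \<in> eigenspace l'" "l \<noteq> l'"
  shows "v \<bullet> w = 0"
  using assms self_adjoint[of v w] by (auto simp: eigenspace_def)

lemma subspace_eigenspace: "subspace (eigenspace l)"
  unfolding eigenspace_def
  by (auto simp: subspace_def linear_0[OF linear] linear_add[OF linear] linear_scale[OF linear]
      scaleR_add_right)

text \<open>The residual \<open>w = A u - (u \<bullet> A u) u\<close> is orthogonal to \<open>u\<close> and lies in \<open>S\<close>. Moving from \<open>u\<close>
  in its direction would increase the Rayleigh quotient to first order unless \<open>w = 0\<close>.\<close>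

lemma maximizer_is_eigenvector:
  assumes S: "subspace S" "A ` S \<subseteq> S" and u: "u \<in> S" "norm u = 1"
    and max: "\<And>v. v \<in> S \<Longrightarrow> norm v = 1 \<Longrightarrow> v \<bullet> A v \<le> u \<bullet> A u"
  shows "A u = (u \<bullet> A u) *\<^sub>R u"
proof -
  define l where "l = u \<bullet> A u"
  define w where "w = A u - l *\<^sub>R u"
  have uu: "u \<bullet> u = 1"
    using u(2) by (simp add: norm_eq_1)
  have wS: "w \<in> S"
    unfolding w_def using S u by (intro subspace_diff subspace_scale) auto
  have uw: "u \<bullet> w = 0"
    by (simp add: w_def inner_diff_right uu l_def)
  have wAu: "w \<bullet> A u = w \<bullet> w"
    using uw by (simp add: w_def inner_diff_right inner_diff_left inner_commute)
  have bound: "v \<bullet> A v \<le> l * (v \<bullet> v)" if "v \<in> S" for v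
  proof (cases "v = 0")
    case True
    then show ?thesis by (simp add: linear_0[OF linear])
  next
    case False
    have "sgn v \<bullet> A (sgn v) \<le> l"
      unfolding l_def using False that S(1)
      by (intro max) (auto simp: sgn_div_norm subspace_scale)
    then show ?thesis
      using False
      by (simp add: sgn_div_norm linear_scale[OF linear] divide_simps dot_square_norm power2_eq_square)
  qed
  \<comment> \<open>Comparing the two sides at \<open>u + t w\<close> shows that \<open>2 t |w|\<^sup>2\<close> is at most quadratic in \<open>t\<close>.\<close>
  have quad: "2 * t * (w \<bullet> w) \<le> t\<^sup>2 * (l * (w \<bullet> w) - w \<bullet> A w)" for t
  proof -
    have "u + t *\<^sub>R w \<in> S"
      using S(1) u(1) wS by (intro subspace_add subspace_scale)
    from bound[OF this] show ?thesis
      using uw uu wAu self_adjoint[of u w]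
      by (simp add: linear_add[OF linear] linear_scale[OF linear] inner_add_left inner_add_right
          l_def[symmetric] inner_commute[of w u] inner_commute[of "A u" w] algebra_simps power2_eq_square)
  qed
  have "w \<bullet> w \<le> 0"
  proof (rule ccontr)
    assume "\<not> w \<bullet> w \<le> 0"
    then have pos: "w \<bullet> w > 0" by linarith
    define c where "c = l * (w \<bullet> w) - w \<bullet> A w"
    \<comment> \<open>A step small enough for the quadratic term not to outweigh the linear one.\<close>
    define t where "t = (w \<bullet> w) / (\<bar>c\<bar> + 1)"
    have t: "t > 0" using pos by (simp add: t_def)
    have "2 * (w \<bullet> w) \<le> t * c"
      using quad[of t] t by (simp add: c_def power2_eq_square)
    also have "t * c \<le> t * (\<bar>c\<bar> + 1)"
      using t by (intro mult_left_mono) auto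
    also have "\<dots> = w \<bullet> w"
      by (simp add: t_def)
    finally show False using pos by simp
  qed
  then have "w = 0"
    using inner_ge_zero[of w] by (simp add: order_antisym_conv)
  then show ?thesis by (simp add: w_def l_def)
qed

text \<open>A unit vector uncorrelated with \<open>n 1, \<dots>, n (j - 1)\<close> has no component along them, because
  the eigenvalues do not vanish. Its variance is then a weighted average of the eigenvalues from the \<open>j\<close>-th on.\<close>

lemma ordered_eigenbasis_maximizes:
  assumes "ordered_eigenbasis n"
  shows "successive_maximizers n"
  unfolding successive_maximizers_def
proof (intro ballI conjI allI impI)
  define \<kappa> where "\<kappa> i = n i \<bullet> A (n i)" for i
  have on: "orthonormal_family n"
    and eig: "\<And>i. i \<in> {1..DIM('a)} \<Longrightarrow> A (n i) = \<kappa> i *\<^sub>R n i"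
    and ord: "\<And>i j. i \<in> {1..DIM('a)} \<Longrightarrow> j \<in> {1..DIM('a)} \<Longrightarrow> i \<le> j \<Longrightarrow> \<kappa> j \<le> \<kappa> i"
    using assms unfolding ordered_eigenbasis_def \<kappa>_def by blast+
  have pos: "0 < \<kappa> i" if "i \<in> {1..DIM('a)}" for i
    unfolding \<kappa>_def using orthonormal_familyD[OF on that that] by (intro positive) auto
  fix j assume j: "j \<in> {1..DIM('a)}"
  show "norm (n j) = 1"
    using orthonormal_familyD[OF on j j] by (simp add: norm_eq_1)
  show "n j \<bullet> A (n i) = 0" if "i \<in> {1..<j}" for i
    using that j eig[of i] orthonormal_familyD[OF on j, of i] by simp
  fix v assume v: "norm v = 1 \<and> (\<forall>i\<in>{1..<j}. v \<bullet> A (n i) = 0)"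
  have coeff: "n i \<bullet> A v = \<kappa> i * (n i \<bullet> v)" if "i \<in> {1..DIM('a)}" for i
    using self_adjoint[of "n i" v] eig[OF that] by simp
  have "v \<bullet> A v = (\<Sum>i\<in>{1..DIM('a)}. \<kappa> i * (n i \<bullet> v)\<^sup>2)"
    unfolding inner_orthonormal_expansion[OF on, of v "A v"]
    by (intro sum.cong refl) (simp add: coeff power2_eq_square)
  also have "\<dots> \<le> (\<Sum>i\<in>{1..DIM('a)}. \<kappa> j * (n i \<bullet> v)\<^sup>2)"
  proof (rule sum_mono)
    fix i assume i: "i \<in> {1..DIM('a)}"
    show "\<kappa> i * (n i \<bullet> v)\<^sup>2 \<le> \<kappa> j * (n i \<bullet> v)\<^sup>2"
    proof (cases "i < j")
      case True
      then have "n i \<bullet> A v = 0"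
        using v i self_adjoint[of "n i" v] by (simp add: inner_commute)
      then have "n i \<bullet> v = 0"
        using coeff[OF i] pos[OF i] by simp
      then show ?thesis by simp
    next
      case False
      then show ?thesis using ord[OF j i] by (intro mult_right_mono) auto
    qed
  qed
  also have "\<dots> = \<kappa> j"
    using v inner_orthonormal_expansion[OF on, of v v]
    by (simp add: sum_distrib_left[symmetric] power2_eq_square norm_eq_1)
  finally show "v \<bullet> A v \<le> n j \<bullet> A (n j)" by (simp add: \<kappa>_def)
qed


text \<open>Once \<open>n 1, \<dots>, n (j - 1)\<close> are known to be eigenvectors, the constraint set of step \<open>j\<close> is an
  invariant subspace, so the next maximizer is an eigenvector as well. The variances do not increase because
  the constraint sets shrink.\<close>

lemma maximizers_form_eigenbasis:
  assumes "successive_maximizers n"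
  shows "ordered_eigenbasis n"
proof -
  have unit: "norm (n j) = 1" if "j \<in> {1..DIM('a)}" for j
    using assms that unfolding successive_maximizers_def by blast
  have unc: "n j \<bullet> A (n i) = 0" if "j \<in> {1..DIM('a)}" "i \<in> {1..<j}" for i j
    using assms that unfolding successive_maximizers_def by blast
  have max: "v \<bullet> A v \<le> n j \<bullet> A (n j)"
    if "j \<in> {1..DIM('a)}" "norm v = 1" "\<forall>i\<in>{1..<j}. v \<bullet> A (n i) = 0" for j v
    using assms that unfolding successive_maximizers_def by blast
  have eig: "A (n j) = (n j \<bullet> A (n j)) *\<^sub>R n j" if "j \<in> {1..DIM('a)}" for j
    using that
  proof (induction j rule: less_induct)
    case (less j)
    let ?S = "{v. \<forall>i\<in>{1..<j}. v \<bullet> A (n i) = 0}"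
    have "subspace ?S"
      by (auto simp: subspace_def inner_add_left)
    moreover have "A ` ?S \<subseteq> ?S"
    proof clarify
      fix v i assume v: "\<forall>i\<in>{1..<j}. v \<bullet> A (n i) = 0" and i: "i \<in> {1..<j}"
      have "A (n i) = (n i \<bullet> A (n i)) *\<^sub>R n i"
        using less i by simp
      then have "A v \<bullet> A (n i) = (n i \<bullet> A (n i)) * (v \<bullet> A (n i))"
        by (metis inner_scaleR_right self_adjoint)
      then show "A v \<bullet> A (n i) = 0" using v i by simp
    qed
    moreover have "n j \<in> ?S"
      using unc less.prems by blast
    ultimately show ?case
      using unit[OF less.prems] max[OF less.prems] by (intro maximizer_is_eigenvector) auto
  qed
  have lt: "n j \<bullet> n i = 0" if ij: "i \<in> {1..DIM('a)}" "j \<in> {1..DIM('a)}" "i < j" for i j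
  proof -
    have "0 < n i \<bullet> A (n i)"
      using unit[OF ij(1)] by (intro positive) auto
    moreover have "(n i \<bullet> A (n i)) * (n j \<bullet> n i) = 0"
      using unc[OF ij(2), of i] ij eig[OF ij(1)] by (metis atLeastAtMost_iff atLeastLessThan_iff inner_scaleR_right)
    ultimately show ?thesis by simp
  qed
  have "orthonormal_family n"
    unfolding orthonormal_family_def
  proof (intro ballI)
    fix i j assume ij: "i \<in> {1..DIM('a)}" "j \<in> {1..DIM('a)}"
    show "n i \<bullet> n j = (if i = j then 1 else 0)"
      using lt[OF ij] lt[OF ij(2,1)] unit[OF ij(1)]
      by (cases i j rule: linorder_cases) (auto simp: norm_eq_1 inner_commute)
  qed
  moreover have "n j \<bullet> A (n j) \<le> n i \<bullet> A (n i)"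
    if ij: "i \<in> {1..DIM('a)}" "j \<in> {1..DIM('a)}" "i \<le> j" for i j
    using unit[OF ij(2)] unc[OF ij(2)] ij by (intro max) auto
  ultimately show ?thesis
    using eig unfolding ordered_eigenbasis_def by blast
qed

lemma successive_maximizers_iff: "successive_maximizers n \<longleftrightarrow> ordered_eigenbasis n"
  using maximizers_form_eigenbasis ordered_eigenbasis_maximizes by blast

text \<open>Each step maximizes a continuous function on the unit sphere of a nonzero subspace.\<close>

lemma successive_maximizers_exist: "\<exists>n. successive_maximizers n"
proof -
  define Q where "Q f j v \<longleftrightarrow> norm v = 1 \<and> (\<forall>i\<in>{1..<j}. v \<bullet> A (f i) = 0)" for f and j :: nat and v
  define R where "R f j u \<longleftrightarrow>
    (j \<in> {1..DIM('a)} \<longrightarrow> Q f j u \<and> (\<forall>v. Q f j v \<longrightarrow> v \<bullet> A v \<le> u \<bullet> A u))" for f and j :: nat and u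
  have "\<exists>n. \<forall>j. R n j (n j)"
  proof (rule dependent_wellorder_choice)
    fix u and f g :: "nat \<Rightarrow> 'a" and j :: nat
    assume "\<And>i. i < j \<Longrightarrow> f i = g i"
    then have "Q f j = Q g j" by (auto simp: Q_def fun_eq_iff)
    then show "R f j u = R g j u" by (simp add: R_def)
  next
    fix j :: nat and f :: "nat \<Rightarrow> 'a"
    have "\<exists>u. Q f j u \<and> (\<forall>v. Q f j v \<longrightarrow> v \<bullet> A v \<le> u \<bullet> A u)" if j: "j \<in> {1..DIM('a)}"
    proof -
      \<comment> \<open>Fewer than \<open>DIM('a)\<close> linear constraints leave a nonzero vector.\<close>
      let ?T = "(\<lambda>i. A (f i)) ` {1..<j}"
      have "dim ?T \<le> card {1..<j}"
        by (meson card_image_le dim_le_card' finite_atLeastLessThan finite_imageI order_trans)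
      then have "dim ?T < DIM('a)" using j by auto
      then obtain x where x: "x \<noteq> 0" "\<And>y. y \<in> span ?T \<Longrightarrow> orthogonal x y"
        using orthogonal_to_subspace_exists by metis
      have "x \<bullet> A (f i) = 0" if "i \<in> {1..<j}" for i
        using x(2)[OF span_base, of "A (f i)"] that by (auto simp: orthogonal_def)
      then have "sgn x \<in> Collect (Q f j)"
        using x(1) by (simp add: Q_def norm_sgn sgn_div_norm)
      moreover have "Collect (Q f j) = sphere 0 1 \<inter> (\<Inter>i\<in>{1..<j}. {v. A (f i) \<bullet> v = 0})"
        by (auto simp: Q_def inner_commute)
      then have "compact (Collect (Q f j))"
        by (simp add: compact_Int_closed closed_INT closed_hyperplane)
      moreover have "continuous_on (Collect (Q f j)) (\<lambda>v. v \<bullet> A v)"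
        by (intro continuous_intros linear_continuous_on linear_conv_bounded_linear[THEN iffD1] linear)
      ultimately show ?thesis
        using continuous_attains_sup[of "Collect (Q f j)" "\<lambda>v. v \<bullet> A v"] by blast
    qed
    then show "\<exists>u. R f j u" unfolding R_def by blast
  qed
  then show ?thesis
    unfolding R_def Q_def successive_maximizers_def by blast
qed

text \<open>A vector of the eigenspace is orthogonal to all basis vectors with other eigenvalues, so its
  expansion contains only those with eigenvalue \<open>l\<close>.\<close>

lemma eigenspace_eq_span:
  assumes n: "ordered_eigenbasis n"
  shows "eigenspace l = span (n ` {j \<in> {1..DIM('a)}. n j \<bullet> A (n j) = l})" (is "_ = span (n ` ?S)")
proof (intro equalityI span_minimal subspace_eigenspace)
  have on: "orthonormal_family n"
    and eig: "\<And>j. j \<in> {1..DIM('a)} \<Longrightarrow> n j \<in> eigenspace (n j \<bullet> A (n j))"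
    using n unfolding ordered_eigenbasis_def eigenspace_def by blast+
  show "n ` ?S \<subseteq> eigenspace l"
    using eig by blast
  show "eigenspace l \<subseteq> span (n ` ?S)"
  proof
    fix v assume v: "v \<in> eigenspace l"
    have "(n j \<bullet> v) *\<^sub>R n j \<in> span (n ` ?S)" if j: "j \<in> {1..DIM('a)}" for j
    proof (cases "j \<in> ?S")
      case True
      then show ?thesis by (intro span_scale span_base) blast
    next
      case False
      then have "n j \<bullet> v = 0"
        using eigenspace_orthogonal[OF eig[OF j] v] j by blast
      then show ?thesis by (simp add: span_zero)
    qed
    then show "v \<in> span (n ` ?S)"
      by (subst orthonormal_expansion[OF on, of v]) (rule span_sum)
  qed
qed

lemma card_multiplicity:
  assumes n: "ordered_eigenbasis n"
  shows "card {j \<in> {1..DIM('a)}. n j \<bullet> A (n j) = l} = dim (eigenspace l)"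
proof -
  let ?S = "{j \<in> {1..DIM('a)}. n j \<bullet> A (n j) = l}"
  have on: "orthonormal_family n"
    using n by (simp add: ordered_eigenbasis_def)
  have "dim (eigenspace l) = card (n ` ?S)"
    unfolding eigenspace_eq_span[OF n]
    by (intro dim_span_eq_card_independent orthonormal_family_independent[OF on]) blast
  also have "\<dots> = card ?S"
    by (intro card_image inj_on_subset[OF orthonormal_family_inj_on[OF on]]) blast
  finally show ?thesis by simp
qed

lemma eigenvalues_eq:
  assumes n: "ordered_eigenbasis n"
  shows "eigenvalues = (\<lambda>j. n j \<bullet> A (n j)) ` {1..DIM('a)}"
proof -
  have "l \<in> eigenvalues \<longleftrightarrow> dim (eigenspace l) \<noteq> 0" for l
    by (auto simp: eigenvalues_def)
  then show ?thesis
    unfolding card_multiplicity[OF n, symmetric] by auto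
qed

text \<open>Diagonalizability: grouping the members of an eigenbasis by eigenvalue, each group
  spans its eigenspace.\<close>

lemma
  shows finite_eigenvalues: "finite eigenvalues"
    and sum_dim_eigenspaces: "(\<Sum>l\<in>eigenvalues. dim (eigenspace l)) = DIM('a)"
proof -
  obtain n where n: "ordered_eigenbasis n"
    using successive_maximizers_exist successive_maximizers_iff by blast
  show fin: "finite eigenvalues"
    by (simp add: eigenvalues_eq[OF n])
  have "(\<Sum>l\<in>eigenvalues. dim (eigenspace l))
      = (\<Sum>l\<in>eigenvalues. card {j \<in> {1..DIM('a)}. n j \<bullet> A (n j) = l})"
    by (simp only: card_multiplicity[OF n])
  also have "\<dots> = (\<Sum>j\<in>{1..DIM('a)}. card {l \<in> eigenvalues. n j \<bullet> A (n j) = l})"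
    by (subst sum_multicount_gen[of eigenvalues "{1..DIM('a)}" "\<lambda>l j. n j \<bullet> A (n j) = l"])
      (use fin in auto)
  also have "\<dots> = (\<Sum>j\<in>{1..DIM('a)}. 1)"
  proof (rule sum.cong)
    fix j assume "j \<in> {1..DIM('a)}"
    then have "{l \<in> eigenvalues. n j \<bullet> A (n j) = l} = {n j \<bullet> A (n j)}"
      by (auto simp: eigenvalues_eq[OF n])
    then show "card {l \<in> eigenvalues. n j \<bullet> A (n j) = l} = 1" by simp
  qed simp
  finally show "(\<Sum>l\<in>eigenvalues. dim (eigenspace l)) = DIM('a)" by simp
qed

end

section \<open>The inertia operator at a point\<close>

lemma DIM_vec: "DIM(real ^ 'k) = CARD('k)"
  by simp

lemma total_mass_pos:
  fixes m :: "'N::finite \<Rightarrow> real"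
  assumes "\<And>j. m j > 0"
  shows "total_mass m > 0"
  unfolding total_mass_def using assms by (intro sum_pos) auto

text \<open>The mixed terms of \<open>(r\<^sub>j - p) \<otimes> (r\<^sub>j - p)\<close> cancel in the sum, since \<open>\<Sum>\<^sub>j m\<^sub>j r\<^sub>j = 0\<close> when the \<open>r\<^sub>j\<close>
  are measured from the center of masses.\<close>

lemma parallel_axis:
  fixes M :: "'N::finite \<Rightarrow> real ^ 'k" and P :: "real ^ 'k"
  assumes "total_mass m \<noteq> 0"
  defines "p \<equiv> P - center_of_mass M m"
  shows "inertia_op M m P v
    = inertia_op M m (center_of_mass M m) v + (total_mass m * (p \<bullet> v)) *\<^sub>R p"
proof -
  define r where "r j = M j - center_of_mass M m" for j
  have "(\<Sum>j\<in>UNIV. m j *\<^sub>R M j) = total_mass m *\<^sub>R center_of_mass M m"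
    using assms(1) by (simp add: center_of_mass_def)
  then have first: "(\<Sum>j\<in>UNIV. m j *\<^sub>R r j) = 0"
    by (simp add: r_def scaleR_diff_right sum_subtractf total_mass_def scaleR_sum_left)
  then have "(\<Sum>j\<in>UNIV. m j *\<^sub>R r j) \<bullet> v = 0" by simp
  then have first': "(\<Sum>j\<in>UNIV. m j * (r j \<bullet> v)) = 0"
    by (simp add: inner_sum_left)
  have "inertia_op M m P v = (\<Sum>j\<in>UNIV. (m j * ((r j - p) \<bullet> v)) *\<^sub>R (r j - p))"
    by (simp add: inertia_op_def r_def p_def)
  also have "\<dots> = (\<Sum>j\<in>UNIV. (m j * (r j \<bullet> v)) *\<^sub>R r j - (m j * (r j \<bullet> v)) *\<^sub>R p
      - (p \<bullet> v) *\<^sub>R (m j *\<^sub>R r j) + (m j * (p \<bullet> v)) *\<^sub>R p)"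
    by (intro sum.cong refl) (simp add: inner_diff_left algebra_simps)
  also have "\<dots> = (\<Sum>j\<in>UNIV. (m j * (r j \<bullet> v)) *\<^sub>R r j)
      - (\<Sum>j\<in>UNIV. m j * (r j \<bullet> v)) *\<^sub>R p - (p \<bullet> v) *\<^sub>R (\<Sum>j\<in>UNIV. m j *\<^sub>R r j)
      + (total_mass m * (p \<bullet> v)) *\<^sub>R p"
    by (simp only: sum.distrib sum_subtractf scaleR_sum_left scaleR_sum_right total_mass_def
        sum_distrib_right)
  also have "\<dots> = inertia_op M m (center_of_mass M m) v + (total_mass m * (p \<bullet> v)) *\<^sub>R p"
    by (simp only: first first') (simp add: inertia_op_def r_def)
  finally show ?thesis .
qed

text \<open>If \<open>v \<bullet> A v = \<Sum>\<^sub>j m\<^sub>j ((M\<^sub>j - P) \<bullet> v)\<^sup>2\<close> vanished, all points would lie in the hyperplane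
  through \<open>P\<close> with normal \<open>v\<close>.\<close>

lemma positive_operator_inertia_op:
  fixes M :: "'N::finite \<Rightarrow> real ^ 'k"
  assumes masses: "\<And>j. m j > 0"
    and not_in_hyperplane: "\<not> (\<exists>a b. a \<noteq> 0 \<and> (\<forall>j. a \<bullet> M j = b))"
  shows "positive_operator (inertia_op M m P)"
proof (rule positive_operator.intro)
  show "linear (inertia_op M m P)" by (rule linear_inertia_op)
  show "inertia_op M m P v \<bullet> w = v \<bullet> inertia_op M m P w" for v w
    by (rule inertia_op_symmetric)
  fix v :: "real ^ 'k" assume "v \<noteq> 0"
  then obtain j where "v \<bullet> M j \<noteq> v \<bullet> P"
    using not_in_hyperplane by blast
  then have "(M j - P) \<bullet> v \<noteq> 0"
    by (simp add: inner_diff_left inner_commute[of v])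
  then have "0 < m j * ((M j - P) \<bullet> v)\<^sup>2"
    using masses by simp
  also have "\<dots> \<le> (\<Sum>j\<in>UNIV. m j * ((M j - P) \<bullet> v)\<^sup>2)"
    using masses by (intro member_le_sum) (auto simp: less_imp_le)
  also have "\<dots> = v \<bullet> inertia_op M m P v"
    by (simp add: inertia_op_symmetric[symmetric] inertia_op_inner power2_eq_square mult.assoc)
  finally show "0 < v \<bullet> inertia_op M m P v" .
qed

lemma restricted_pca_iff_successive_maximizers:
  fixes M :: "'N::finite \<Rightarrow> real ^ 'k"
  assumes "positive_operator (inertia_op M m P)"
  shows "restricted_pca M m P n \<longleftrightarrow>
    positive_operator.successive_maximizers (inertia_op M m P) n"
  unfolding restricted_pca_def positive_operator.successive_maximizers_def[OF assms]
    covariance_def DIM_vec ..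

lemma line_through_scaleR:
  assumes "c \<noteq> 0"
  shows "line_through P (c *\<^sub>R v) = line_through P v"
proof -
  have "\<exists>s. P + t *\<^sub>R v = P + s *\<^sub>R (c *\<^sub>R v)" for t
    using assms by (intro exI[of _ "t / c"]) simp
  moreover have "\<exists>s. P + t *\<^sub>R (c *\<^sub>R v) = P + s *\<^sub>R v" for t
    by (intro exI[of _ "t * c"]) simp
  ultimately show ?thesis
    unfolding line_through_def by blast
qed

lemma line_through_eqD:
  assumes "line_through P v = line_through P w"
  obtains t where "v = t *\<^sub>R w"
proof -
  have "P + 1 *\<^sub>R v \<in> line_through P v" unfolding line_through_def by blast
  then have "P + v \<in> line_through P w" using assms by simp
  then show ?thesis using that unfolding line_through_def by auto
qed

lemma hyperplane_through_scaleR: "c \<noteq> 0 \<Longrightarrow> hyperplane_through P (c *\<^sub>R v) = hyperplane_through P v"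
  by (simp add: hyperplane_through_def)

text \<open>For \<open>w\<close> orthogonal to \<open>v\<close>, the point \<open>P + w\<close> lies in the hyperplane with normal \<open>v\<close>, but in that with
  normal \<open>w\<close> only if \<open>w = 0\<close>. So members of an orthonormal family have different hyperplanes.\<close>

lemma hyperplane_through_eqD:
  assumes "hyperplane_through P v = hyperplane_through P w" "v \<bullet> w = 0"
  shows "w = 0"
proof -
  have "P + w \<in> hyperplane_through P v" using assms(2) by (simp add: hyperplane_through_def)
  then have "P + w \<in> hyperplane_through P w" using assms(1) by simp
  then show ?thesis by (simp add: hyperplane_through_def)
qed

section \<open>Eigenspaces of the inertia operator and the confocal pencil\<close>

locale confocal_pencil =
  fixes M :: "'N::finite \<Rightarrow> real ^ 'k" and m :: "'N \<Rightarrow> real"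
    and e :: "nat \<Rightarrow> real ^ 'k" and J :: "nat \<Rightarrow> real" and P :: "real ^ 'k"
  assumes masses: "\<And>j. m j > 0"
    and not_in_hyperplane: "\<not> (\<exists>a b. a \<noteq> 0 \<and> (\<forall>j. a \<bullet> M j = b))"
    and principal: "central_principal_system M m e J"
    and J_inj: "inj_on J {1..CARD('k)}"
begin

sublocale positive_operator "inertia_op M m P"
  using masses not_in_hyperplane by (rule positive_operator_inertia_op)

definition p :: "real ^ 'k" where
  "p = P - center_of_mass M m"

abbreviation mass :: real where
  "mass \<equiv> total_mass m"

lemma mass_pos: "mass > 0"
  using masses by (rule total_mass_pos)

lemma orthonormal_e: "orthonormal_family e"
  using principal by (simp add: orthonormal_family_def central_principal_system_def)

lemma e_eqI: "(\<And>i. i \<in> {1..CARD('k)} \<Longrightarrow> e i \<bullet> v = e i \<bullet> w) \<Longrightarrow> v = w"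
  using orthonormal_family_eqI[OF orthonormal_e] by simp

lemma inner_e_e: "i \<in> {1..CARD('k)} \<Longrightarrow> l \<in> {1..CARD('k)} \<Longrightarrow> e i \<bullet> e l = (if i = l then 1 else 0)"
  using orthonormal_familyD[OF orthonormal_e] by simp

lemma inner_e_inertia_op:
  assumes "i \<in> {1..CARD('k)}"
  shows "e i \<bullet> inertia_op M m P v = J i * (e i \<bullet> v) + mass * (p \<bullet> v) * (e i \<bullet> p)"
proof -
  have "e i \<bullet> inertia_op M m (center_of_mass M m) v = J i * (e i \<bullet> v)"
    using principal assms
    by (simp add: inertia_op_symmetric[symmetric] central_principal_system_def)
  then show ?thesis
    using mass_pos by (simp add: parallel_axis[where M = M and m = m and P = P] inner_add_right p_def)
qed

text \<open>The eigenvalue equation in principal coordinates at the center of masses, on which the whole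
  comparison with the pencil rests.\<close>

lemma mem_eigenspace_iff:
  "v \<in> eigenspace \<mu> \<longleftrightarrow>
    (\<forall>i\<in>{1..CARD('k)}. (\<mu> - J i) * (e i \<bullet> v) = mass * (p \<bullet> v) * (e i \<bullet> p))"
proof -
  have "v \<in> eigenspace \<mu> \<longleftrightarrow>
      (\<forall>i\<in>{1..CARD('k)}. e i \<bullet> inertia_op M m P v = e i \<bullet> (\<mu> *\<^sub>R v))"
    unfolding eigenspace_def using e_eqI by auto
  also have "\<dots> \<longleftrightarrow>
      (\<forall>i\<in>{1..CARD('k)}. (\<mu> - J i) * (e i \<bullet> v) = mass * (p \<bullet> v) * (e i \<bullet> p))"
    by (intro ball_cong refl) (auto simp: inner_e_inertia_op left_diff_distrib)
  finally show ?thesis .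
qed

text \<open>For \<open>\<mu>\<close> different from all \<open>J i\<close> this is half the gradient at \<open>P\<close> of the defining function of the
  quadric. For \<open>\<mu> = J i\<close> division by zero drops the \<open>i\<close>-th term, which leaves half
  the gradient of the function that defines the focal quadric inside \<open>x\<^sub>i = 0\<close>: the second
  eigenvector at focal points.\<close>

definition gradient :: "real \<Rightarrow> real ^ 'k" where
  "gradient \<mu> = (\<Sum>i\<in>{1..CARD('k)}. ((e i \<bullet> p) / (\<mu> - J i)) *\<^sub>R e i)"

definition normal :: "real \<Rightarrow> real ^ 'k" where
  "normal \<mu> = (if \<mu> \<in> J ` {1..CARD('k)} then e (THE i. i \<in> {1..CARD('k)} \<and> J i = \<mu>)
    else gradient \<mu>)"

lemma inner_e_gradient:
  assumes "i \<in> {1..CARD('k)}"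
  shows "e i \<bullet> gradient \<mu> = (e i \<bullet> p) / (\<mu> - J i)"
  using inner_sum_orthonormal_family[OF orthonormal_e, of i "\<lambda>i. (e i \<bullet> p) / (\<mu> - J i)"] assms
  by (simp add: gradient_def)

lemma inner_p_gradient: "p \<bullet> gradient \<mu> = (\<Sum>i\<in>{1..CARD('k)}. (e i \<bullet> p)\<^sup>2 / (\<mu> - J i))"
  unfolding gradient_def inner_sum_right
  by (intro sum.cong refl) (simp add: inner_commute power2_eq_square)

lemma index_of_J:
  assumes "i \<in> {1..CARD('k)}"
  shows "(THE l. l \<in> {1..CARD('k)} \<and> J l = J i) = i"
  using assms J_inj by (intro the_equality) (auto dest: inj_onD)

lemma normal_J: "i \<in> {1..CARD('k)} \<Longrightarrow> normal (J i) = e i"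
  unfolding normal_def by (simp only: index_of_J) auto

lemma normal_regular: "\<mu> \<notin> J ` {1..CARD('k)} \<Longrightarrow> normal \<mu> = gradient \<mu>"
  by (simp only: normal_def if_False)

lemma confocal_function_J:
  "i \<in> {1..CARD('k)} \<Longrightarrow>
    confocal_function M m e J (J i) = (\<lambda>x. e i \<bullet> (x - center_of_mass M m))"
  unfolding confocal_function_def central_coord_def
  by (simp only: index_of_J) auto

lemma confocal_function_regular:
  "\<mu> \<notin> J ` {1..CARD('k)} \<Longrightarrow> confocal_function M m e J \<mu> =
    (\<lambda>x. (\<Sum>i\<in>{1..CARD('k)}. (e i \<bullet> (x - center_of_mass M m))\<^sup>2 / (\<mu> - J i)) - 1 / mass)"
  unfolding confocal_function_def central_coord_def by (simp only: if_False)

lemma params_J_iff: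
  "i \<in> {1..CARD('k)} \<Longrightarrow> J i \<in> confocal_params_at M m e J P \<longleftrightarrow> e i \<bullet> p = 0"
  by (simp add: confocal_params_at_def confocal_quadric_def confocal_function_J p_def)

lemma params_regular_iff:
  "\<mu> \<notin> J ` {1..CARD('k)} \<Longrightarrow>
    \<mu> \<in> confocal_params_at M m e J P \<longleftrightarrow> p \<bullet> gradient \<mu> = 1 / mass"
  by (simp add: confocal_params_at_def confocal_quadric_def confocal_function_regular
      inner_p_gradient flip: p_def)

text \<open>The \<open>i\<close>-th term of the sum is a division by zero, hence it may be included.\<close>

lemma focal_indices_iff:
  "i \<in> focal_indices M m e J P \<longleftrightarrow>
    i \<in> {1..CARD('k)} \<and> e i \<bullet> p = 0 \<and> p \<bullet> gradient (J i) = 1 / mass"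
proof -
  have "p \<bullet> gradient (J i) = (\<Sum>l\<in>{1..CARD('k)} - {i}. (e l \<bullet> p)\<^sup>2 / (J i - J l))"
    if "i \<in> {1..CARD('k)}"
    unfolding inner_p_gradient using that by (subst sum.remove[of _ i]) auto
  then show ?thesis
    by (auto simp: focal_indices_def central_coord_def p_def)
qed

lemma eigenvector_regular:
  assumes "\<mu> \<notin> J ` {1..CARD('k)}" "v \<in> eigenspace \<mu>"
  shows "v = (mass * (p \<bullet> v)) *\<^sub>R gradient \<mu>"
proof (rule e_eqI)
  fix i assume i: "i \<in> {1..CARD('k)}"
  then have "\<mu> - J i \<noteq> 0" using assms(1) by auto
  then have "e i \<bullet> v = mass * (p \<bullet> v) * (e i \<bullet> p) / (\<mu> - J i)"
    using bspec[OF iffD1[OF mem_eigenspace_iff assms(2)] i]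
    by (metis nonzero_mult_div_cancel_left)
  then show "e i \<bullet> v = e i \<bullet> ((mass * (p \<bullet> v)) *\<^sub>R gradient \<mu>)"
    by (simp only: inner_scaleR_right inner_e_gradient[OF i] times_divide_eq_right)
qed

text \<open>The \<open>i\<close>-th coordinate of the eigenvalue equation is \<open>0 = m (p \<bullet> v) p\<^sub>i\<close> and leaves \<open>v\<^sub>i\<close>
  free; the other coordinates are determined as in the regular case.\<close>

lemma eigenvector_J:
  assumes i: "i \<in> {1..CARD('k)}" and v: "v \<in> eigenspace (J i)"
  shows "p \<bullet> v = 0 \<or> e i \<bullet> p = 0"
    and "v = (e i \<bullet> v) *\<^sub>R e i + (mass * (p \<bullet> v)) *\<^sub>R gradient (J i)"
proof -
  show "p \<bullet> v = 0 \<or> e i \<bullet> p = 0"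
    using bspec[OF iffD1[OF mem_eigenspace_iff v] i] mass_pos by auto
  show "v = (e i \<bullet> v) *\<^sub>R e i + (mass * (p \<bullet> v)) *\<^sub>R gradient (J i)"
  proof (rule e_eqI)
    fix l assume l: "l \<in> {1..CARD('k)}"
    show "e l \<bullet> v = e l \<bullet> ((e i \<bullet> v) *\<^sub>R e i + (mass * (p \<bullet> v)) *\<^sub>R gradient (J i))"
    proof (cases "l = i")
      case True
      then show ?thesis
        using i by (simp add: inner_add_right inner_e_e inner_e_gradient)
    next
      case False
      then have "J i - J l \<noteq> 0" using J_inj i l by (auto dest: inj_onD)
      then show ?thesis
        using bspec[OF iffD1[OF mem_eigenspace_iff v] l] False
        by (simp add: inner_add_right inner_e_e[OF l i] inner_e_gradient[OF l]
            nonzero_eq_divide_eq mult_ac)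
    qed
  qed
qed

lemma gradient_nonzero: "p \<bullet> gradient \<mu> = 1 / mass \<Longrightarrow> gradient \<mu> \<noteq> 0"
  using mass_pos by auto

lemma gradient_eigenvector:
  assumes "p \<bullet> gradient \<mu> = 1 / mass" "\<And>i. i \<in> {1..CARD('k)} \<Longrightarrow> J i = \<mu> \<Longrightarrow> e i \<bullet> p = 0"
  shows "gradient \<mu> \<in> eigenspace \<mu>"
  unfolding mem_eigenspace_iff
proof
  fix i assume i: "i \<in> {1..CARD('k)}"
  show "(\<mu> - J i) * (e i \<bullet> gradient \<mu>) = mass * (p \<bullet> gradient \<mu>) * (e i \<bullet> p)"
    using assms(2)[OF i] mass_pos by (cases "J i = \<mu>") (simp_all add: inner_e_gradient[OF i] assms(1))
qed

lemma e_eigenvector: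
  assumes "i \<in> {1..CARD('k)}" "e i \<bullet> p = 0"
  shows "e i \<in> eigenspace (J i)"
  unfolding mem_eigenspace_iff
proof
  fix l assume "l \<in> {1..CARD('k)}"
  then show "(J i - J l) * (e l \<bullet> e i) = mass * (p \<bullet> e i) * (e l \<bullet> p)"
    using assms by (simp add: inner_e_e inner_commute[of p])
qed

lemma normal_eigenvector:
  assumes "\<mu> \<in> confocal_params_at M m e J P"
  shows "normal \<mu> \<in> eigenspace \<mu>" "normal \<mu> \<noteq> 0"
proof -
  have "normal \<mu> \<in> eigenspace \<mu> \<and> normal \<mu> \<noteq> 0"
  proof (cases "\<mu> \<in> J ` {1..CARD('k)}")
    case True
    then obtain i where i: "i \<in> {1..CARD('k)}" "\<mu> = J i" by blast
    then show ?thesis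
      using assms e_eigenvector[of i] inner_e_e[of i i] by (auto simp: normal_J params_J_iff)
  next
    case False
    then have grad: "p \<bullet> gradient \<mu> = 1 / mass"
      using assms params_regular_iff by blast
    then have "gradient \<mu> \<in> eigenspace \<mu>"
      using False by (intro gradient_eigenvector) auto
    then show ?thesis
      using gradient_nonzero[OF grad] normal_regular[OF False] by simp
  qed
  then show "normal \<mu> \<in> eigenspace \<mu>" "normal \<mu> \<noteq> 0" by auto
qed

text \<open>That an eigenvalue is a parameter comes from taking the inner product of an eigenvector with
  \<open>p\<close>: for regular \<open>\<mu>\<close> the factor \<open>p \<bullet> v\<close> cannot vanish, so that it cancels and leaves
  the equation of the quadric; for \<open>\<mu> = J i\<close> with \<open>p\<^sub>i \<noteq> 0\<close> the eigenvector would be zero.\<close>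

lemma params_eq_eigenvalues: "confocal_params_at M m e J P = eigenvalues"
proof (intro equalityI subsetI)
  fix \<mu> assume "\<mu> \<in> confocal_params_at M m e J P"
  then show "\<mu> \<in> eigenvalues"
    using normal_eigenvector unfolding eigenvalues_def by blast
next
  fix \<mu> assume "\<mu> \<in> eigenvalues"
  then obtain v where v: "v \<in> eigenspace \<mu>" "v \<noteq> 0"
    unfolding eigenvalues_def by blast
  show "\<mu> \<in> confocal_params_at M m e J P"
  proof (cases "\<mu> \<in> J ` {1..CARD('k)}")
    case True
    then obtain i where i: "i \<in> {1..CARD('k)}" "\<mu> = J i" by blast
    have "e i \<bullet> p = 0"
    proof (rule ccontr)
      assume "e i \<bullet> p \<noteq> 0"
      then have "p \<bullet> v = 0"
        using eigenvector_J(1)[OF i(1)] v(1) i(2) by blast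
      then have v_eq: "v = (e i \<bullet> v) *\<^sub>R e i"
        using eigenvector_J(2)[OF i(1)] v(1) i(2)
        by (metis add_0_right mult_zero_right scaleR_zero_left)
      have "p \<bullet> v = p \<bullet> ((e i \<bullet> v) *\<^sub>R e i)"
        by (rule arg_cong[OF v_eq])
      then have "e i \<bullet> v = 0"
        using \<open>p \<bullet> v = 0\<close> \<open>e i \<bullet> p \<noteq> 0\<close> by (simp add: inner_commute[of p "e i"])
      then show False
        using v_eq v(2) by (metis scaleR_zero_left)
    qed
    then show ?thesis using i params_J_iff by simp
  next
    case False
    note v_eq = eigenvector_regular[OF False v(1)]
    then have "p \<bullet> v \<noteq> 0" using v(2) by (metis mult_zero_right scaleR_zero_left)
    moreover have "p \<bullet> v = mass * (p \<bullet> v) * (p \<bullet> gradient \<mu>)"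
      using arg_cong[OF v_eq, of "inner p"] unfolding inner_scaleR_right .
    then have "(p \<bullet> v) * (mass * (p \<bullet> gradient \<mu>) - 1) = 0"
      by algebra
    ultimately have "p \<bullet> gradient \<mu> = 1 / mass"
      using mass_pos by (simp add: field_simps)
    then show ?thesis using False by (simp add: params_regular_iff)
  qed
qed

text \<open>For \<open>\<mu> = J i\<close>, a component along \<open>gradient (J i)\<close> requires \<open>p \<bullet> v \<noteq> 0\<close>, and then the inner product
  with \<open>p\<close> gives the equation of the focal quadric.\<close>

lemma eigenspace_nonfocal:
  assumes \<mu>: "\<mu> \<in> confocal_params_at M m e J P" "\<mu> \<notin> J ` focal_indices M m e J P"
  shows "eigenspace \<mu> = span {normal \<mu>}"
proof (intro equalityI span_minimal subspace_eigenspace)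
  show "{normal \<mu>} \<subseteq> eigenspace \<mu>"
    using normal_eigenvector[OF \<mu>(1)] by simp
  show "eigenspace \<mu> \<subseteq> span {normal \<mu>}"
  proof
    fix v assume v: "v \<in> eigenspace \<mu>"
    show "v \<in> span {normal \<mu>}"
    proof (cases "\<mu> \<in> J ` {1..CARD('k)}")
      case True
      then obtain i where i: "i \<in> {1..CARD('k)}" "\<mu> = J i" by blast
      have ei: "e i \<bullet> p = 0" using \<mu>(1) i params_J_iff by simp
      note v_eq = eigenvector_J(2)[OF i(1) v[unfolded i(2)]]
      have "p \<bullet> v = p \<bullet> ((e i \<bullet> v) *\<^sub>R e i + (mass * (p \<bullet> v)) *\<^sub>R gradient (J i))"
        by (rule arg_cong[OF v_eq])
      also have "\<dots> = mass * (p \<bullet> v) * (p \<bullet> gradient (J i))"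
        using ei by (simp add: inner_add_right inner_commute[of p "e i"])
      finally have "p \<bullet> v = mass * (p \<bullet> v) * (p \<bullet> gradient (J i))" .
      moreover have "p \<bullet> gradient (J i) \<noteq> 1 / mass"
        using \<mu>(2) i ei focal_indices_iff by blast
      ultimately have "p \<bullet> v = 0"
        using mass_pos by (auto simp: field_simps)
      then have "v = (e i \<bullet> v) *\<^sub>R e i"
        using v_eq by (metis add_0_right mult_zero_right scaleR_zero_left)
      then show ?thesis
        using i by (metis normal_J span_base span_scale singletonI)
    next
      case False
      then show ?thesis
        using eigenvector_regular[OF False v] normal_regular
        by (metis span_base span_scale singletonI)
    qed
  qed
qed

text \<open>At a focal point both \<open>e i\<close> and \<open>gradient (J i)\<close> are eigenvectors, and they are orthogonal.\<close>

lemma dim_eigenspace_focal: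
  assumes i: "i \<in> focal_indices M m e J P"
  shows "dim (eigenspace (J i)) = 2"
proof -
  have iK: "i \<in> {1..CARD('k)}" and ei: "e i \<bullet> p = 0" and grad: "p \<bullet> gradient (J i) = 1 / mass"
    using i focal_indices_iff by blast+
  let ?B = "{e i, gradient (J i)}"
  have orth: "e i \<bullet> gradient (J i) = 0"
    using iK by (simp add: inner_e_gradient)
  have e0: "e i \<noteq> 0" and g0: "gradient (J i) \<noteq> 0" and ne: "e i \<noteq> gradient (J i)"
    using inner_e_e[OF iK iK] gradient_nonzero[OF grad] orth by auto
  have "eigenspace (J i) = span ?B"
  proof (intro equalityI span_minimal subspace_eigenspace)
    show "?B \<subseteq> eigenspace (J i)"
      using e_eigenvector[OF iK ei] gradient_eigenvector[OF grad] ei inj_onD[OF J_inj] iK by auto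
    show "eigenspace (J i) \<subseteq> span ?B"
    proof
      fix v assume "v \<in> eigenspace (J i)"
      note v_eq = eigenvector_J(2)[OF iK this]
      show "v \<in> span ?B"
        by (subst v_eq) (intro span_add span_scale span_base, auto)
    qed
  qed
  moreover have "independent ?B"
    using e0 g0 orth
    by (intro pairwise_orthogonal_independent)
      (auto simp: pairwise_def orthogonal_def inner_commute)
  ultimately show ?thesis
    using ne dim_span_eq_card_independent[of ?B] by simp
qed

lemma J_inj_focal: "inj_on J (focal_indices M m e J P)"
  by (rule inj_on_subset[OF J_inj]) (auto simp: focal_indices_def)

text \<open>The dimensions of the eigenspaces add up to \<open>CARD('k)\<close>; each parameter contributes one, and
  each focal index one more.\<close>

lemma card_params:
  "card (confocal_params_at M m e J P) + card (focal_indices M m e J P) = CARD('k)"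
proof -
  let ?E = "confocal_params_at M m e J P" and ?F = "J ` focal_indices M m e J P"
  have fin: "finite ?E"
    unfolding params_eq_eigenvalues by (rule finite_eigenvalues)
  have sub: "?F \<subseteq> ?E"
    using focal_indices_iff params_J_iff by blast
  have "dim (eigenspace \<mu>) = (if \<mu> \<in> ?F then 1 else 0) + 1" if "\<mu> \<in> ?E" for \<mu>
    using that normal_eigenvector(2)[OF that]
    by (auto simp: dim_eigenspace_focal eigenspace_nonfocal dim_span_eq_card_independent)
  then have "CARD('k) = (\<Sum>\<mu>\<in>?E. (if \<mu> \<in> ?F then 1 else 0) + 1)"
    using sum_dim_eigenspaces by (simp add: params_eq_eigenvalues)
  also have "\<dots> = (\<Sum>\<mu>\<in>?E. if \<mu> \<in> ?F then 1 else 0) + card ?E"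
    by (simp only: sum.distrib card_eq_sum)
  also have "(\<Sum>\<mu>\<in>?E. if \<mu> \<in> ?F then 1 else 0) = card ?F"
    using sum.inter_restrict[OF fin, of "\<lambda>_. 1 :: nat" ?F] sub by (simp add: Int_absorb1)
  finally show ?thesis
    using card_image[OF J_inj_focal] by simp
qed

lemma tangent_eq: "confocal_tangent M m e J \<mu> P = hyperplane_through P (normal \<mu>)"
proof (cases "\<mu> \<in> J ` {1..CARD('k)}")
  case True
  then obtain i where i: "i \<in> {1..CARD('k)}" "\<mu> = J i" by blast
  have "((\<lambda>x. e i \<bullet> (x - center_of_mass M m)) has_derivative (\<lambda>h. e i \<bullet> h)) (at P)"
    by (auto intro!: derivative_eq_intros)
  then show ?thesis
    unfolding confocal_tangent_def i(2) confocal_function_J[OF i(1)] normal_J[OF i(1)]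
      hyperplane_through_def
    by (simp add: frechet_derivative_at[symmetric])
next
  case False
  have "((\<lambda>x. (e i \<bullet> (x - center_of_mass M m))\<^sup>2 / (\<mu> - J i)) has_derivative
      (\<lambda>h. 2 * (((e i \<bullet> p) / (\<mu> - J i)) *\<^sub>R e i \<bullet> h))) (at P)" for i
    unfolding divide_inverse
    by (auto intro!: derivative_eq_intros simp: p_def)
  then have "((\<lambda>x. (\<Sum>i\<in>{1..CARD('k)}. (e i \<bullet> (x - center_of_mass M m))\<^sup>2 / (\<mu> - J i)) - 1 / mass)
      has_derivative (\<lambda>h. (\<Sum>i\<in>{1..CARD('k)}. 2 * (((e i \<bullet> p) / (\<mu> - J i)) *\<^sub>R e i \<bullet> h)) - 0))
      (at P)"
    by (intro has_derivative_diff has_derivative_sum has_derivative_const)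
  then have "((\<lambda>x. (\<Sum>i\<in>{1..CARD('k)}. (e i \<bullet> (x - center_of_mass M m))\<^sup>2 / (\<mu> - J i)) - 1 / mass)
      has_derivative (\<lambda>h. 2 * (gradient \<mu> \<bullet> h))) (at P)"
    by (simp only: gradient_def inner_sum_left sum_distrib_left diff_0_right)
  then show ?thesis
    unfolding confocal_tangent_def confocal_function_regular[OF False] normal_regular[OF False]
      hyperplane_through_def
    by (simp add: frechet_derivative_at[symmetric])
qed


section \<open>The quadrics, axes and hyperplanes through the point\<close>

lemma mem_quadric_J:
  "i \<in> {1..CARD('k)} \<Longrightarrow>
    x \<in> confocal_quadric M m e J (J i) \<longleftrightarrow> e i \<bullet> (x - center_of_mass M m) = 0"
  by (simp only: confocal_quadric_def confocal_function_J mem_Collect_eq)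

lemma mem_quadric_regular:
  "\<mu> \<notin> J ` {1..CARD('k)} \<Longrightarrow> x \<in> confocal_quadric M m e J \<mu> \<longleftrightarrow>
    (\<Sum>i\<in>{1..CARD('k)}. (e i \<bullet> (x - center_of_mass M m))\<^sup>2 / (\<mu> - J i)) = 1 / mass"
  unfolding confocal_quadric_def mem_Collect_eq
  by (subst confocal_function_regular) simp_all

lemma quadric_meets_axis:
  assumes "\<mu> \<notin> J ` {1..CARD('k)}" "i \<in> {1..CARD('k)}"
  shows "center_of_mass M m + s *\<^sub>R e i \<in> confocal_quadric M m e J \<mu> \<longleftrightarrow> s\<^sup>2 = (\<mu> - J i) / mass"
proof -
  have "\<mu> - J i \<noteq> 0" using assms by auto
  have "(\<Sum>l\<in>{1..CARD('k)}. (e l \<bullet> (s *\<^sub>R e i))\<^sup>2 / (\<mu> - J l))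
      = (\<Sum>l\<in>{1..CARD('k)}. if l = i then s\<^sup>2 / (\<mu> - J i) else 0)"
    using assms(2) by (intro sum.cong refl) (simp add: inner_e_e)
  also have "\<dots> = s\<^sup>2 / (\<mu> - J i)" using assms(2) by simp
  finally have "center_of_mass M m + s *\<^sub>R e i \<in> confocal_quadric M m e J \<mu>
      \<longleftrightarrow> s\<^sup>2 / (\<mu> - J i) = 1 / mass"
    by (simp only: mem_quadric_regular[OF assms(1)] add_diff_cancel_left')
  then show ?thesis
    using \<open>\<mu> - J i \<noteq> 0\<close> mass_pos by (simp add: divide_eq_eq)
qed

text \<open>Degenerate members are the only ones that contain the center, and they are told apart by
  the points \<open>C + e l\<close>. A regular quadric through a point has \<open>\<mu> > J i\<close> for some \<open>i\<close>, otherwise its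
  left-hand side is nonpositive; its intersection with the \<open>i\<close>-th axis then determines \<open>\<mu>\<close>.
  Without a point on the quadrics this fails, since several parameters give the empty set.\<close>

lemma confocal_quadric_inj: "inj_on (confocal_quadric M m e J) (confocal_params_at M m e J P)"
proof (rule inj_onI)
  fix \<mu> \<nu>
  assume \<mu>: "\<mu> \<in> confocal_params_at M m e J P" and \<nu>: "\<nu> \<in> confocal_params_at M m e J P"
    and eq: "confocal_quadric M m e J \<mu> = confocal_quadric M m e J \<nu>"
  have center: "center_of_mass M m \<in> confocal_quadric M m e J \<kappa> \<longleftrightarrow> \<kappa> \<in> J ` {1..CARD('k)}" for \<kappa>
    using mem_quadric_regular[of \<kappa> "center_of_mass M m"] mem_quadric_J[of _ "center_of_mass M m"]
      mass_pos by fastforce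
  show "\<mu> = \<nu>"
  proof (cases "\<mu> \<in> J ` {1..CARD('k)}")
    case True
    then have "\<nu> \<in> J ` {1..CARD('k)}" using eq center by blast
    with True obtain i l where il: "i \<in> {1..CARD('k)}" "\<mu> = J i" "l \<in> {1..CARD('k)}" "\<nu> = J l"
      by blast
    have "e i \<bullet> e l = 0 \<longleftrightarrow> e l \<bullet> e l = 0"
      using mem_quadric_J[OF il(1), of "center_of_mass M m + e l"]
        mem_quadric_J[OF il(3), of "center_of_mass M m + e l"] eq il by simp
    then show ?thesis
      using inner_e_e il by (metis zero_neq_one)
  next
    case False
    then have False': "\<nu> \<notin> J ` {1..CARD('k)}" using eq center by blast
    have "\<exists>i\<in>{1..CARD('k)}. J i < \<mu>"
    proof (rule ccontr)
      assume "\<not> (\<exists>i\<in>{1..CARD('k)}. J i < \<mu>)"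
      then have "p \<bullet> gradient \<mu> \<le> 0"
        unfolding inner_p_gradient
        by (intro sum_nonpos divide_nonneg_nonpos) (auto simp: not_less)
      moreover have "p \<bullet> gradient \<mu> = 1 / mass"
        using params_regular_iff[OF False] \<mu> by blast
      ultimately show False using mass_pos by (simp add: divide_le_0_iff)
    qed
    then obtain i where i: "i \<in> {1..CARD('k)}" "J i < \<mu>" by blast
    define s where "s = sqrt ((\<mu> - J i) / mass)"
    have s: "s\<^sup>2 = (\<mu> - J i) / mass"
      using i(2) mass_pos by (simp add: s_def)
    then have "s\<^sup>2 = (\<nu> - J i) / mass"
      using quadric_meets_axis[OF False i(1), of s] quadric_meets_axis[OF False' i(1), of s] eq by blast
    then show ?thesis using s mass_pos by simp
  qed
qed

lemma card_confocal_quadrics_at: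
  "card (confocal_quadrics_at M m e J P) = card (confocal_params_at M m e J P)"
proof -
  have "confocal_quadrics_at M m e J P = confocal_quadric M m e J ` confocal_params_at M m e J P"
    by (auto simp: confocal_quadrics_at_def confocal_params_at_def)
  then show ?thesis
    by (simp add: card_image[OF confocal_quadric_inj])
qed

lemma principal_direction_iff:
  "principal_direction M m P v \<longleftrightarrow> v \<noteq> 0 \<and> (\<exists>l\<in>confocal_params_at M m e J P. v \<in> eigenspace l)"
  unfolding principal_direction_def params_eq_eigenvalues eigenvalues_def eigenspace_def by blast

lemma tangents_orthogonal:
  assumes "\<mu> \<in> confocal_params_at M m e J P" "\<nu> \<in> confocal_params_at M m e J P" "\<mu> \<noteq> \<nu>"
  shows "orthogonal_hyperplanes (confocal_tangent M m e J \<mu> P) (confocal_tangent M m e J \<nu> P)"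
proof -
  have "normal \<mu> \<bullet> normal \<nu> = 0"
    using normal_eigenvector assms by (blast intro: eigenspace_orthogonal)
  moreover have "hyperplane_through P v = {x. v \<bullet> x = v \<bullet> P}" for v
    by (simp add: hyperplane_through_def inner_diff_right)
  ultimately show ?thesis
    unfolding orthogonal_hyperplanes_def tangent_eq
    using normal_eigenvector(2)[OF assms(1)] normal_eigenvector(2)[OF assms(2)]
    by (intro exI[of _ "normal \<mu>"] exI[of _ "normal \<nu>"] exI[of _ "normal \<mu> \<bullet> P"]
        exI[of _ "normal \<nu> \<bullet> P"]) simp
qed

lemma tangent_principal:
  "\<mu> \<in> confocal_params_at M m e J P \<Longrightarrow>
    confocal_tangent M m e J \<mu> P \<in> principal_hyperplanes M m P"
  unfolding principal_hyperplanes_def tangent_eq principal_direction_iff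
  using normal_eigenvector by blast

lemma tangent_inj: "inj_on (\<lambda>\<mu>. confocal_tangent M m e J \<mu> P) (confocal_params_at M m e J P)"
proof (rule inj_onI, rule ccontr)
  fix \<mu> \<nu>
  assume \<mu>: "\<mu> \<in> confocal_params_at M m e J P" and \<nu>: "\<nu> \<in> confocal_params_at M m e J P"
    and eq: "confocal_tangent M m e J \<mu> P = confocal_tangent M m e J \<nu> P" and "\<mu> \<noteq> \<nu>"
  then have "normal \<mu> \<bullet> normal \<nu> = 0"
    using normal_eigenvector by (blast intro: eigenspace_orthogonal)
  then show False
    using hyperplane_through_eqD[OF eq[unfolded tangent_eq]] normal_eigenvector(2)[OF \<nu>] by blast
qed

text \<open>Away from the focal quadrics all eigenspaces are lines.\<close>

lemma eigenvectors_parallel: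
  assumes "focal_indices M m e J P = {}" "v \<in> eigenspace l" "w \<in> eigenspace l" "v \<noteq> 0" "w \<noteq> 0"
  obtains c where "c \<noteq> 0" "v = c *\<^sub>R w"
proof -
  have "l \<in> confocal_params_at M m e J P"
    unfolding params_eq_eigenvalues eigenvalues_def using assms by blast
  then have "eigenspace l = span {normal l}"
    using eigenspace_nonfocal assms(1) by blast
  then obtain a b where ab: "v = a *\<^sub>R normal l" "w = b *\<^sub>R normal l"
    using assms(2,3) by (auto simp: span_singleton)
  then have "a / b \<noteq> 0" "v = (a / b) *\<^sub>R w"
    using assms(4,5) by auto
  then show ?thesis using that by blast
qed

lemma tangents_eq_principal_hyperplanes:
  assumes "focal_indices M m e J P = {}"
  shows "(\<lambda>\<mu>. confocal_tangent M m e J \<mu> P) ` confocal_params_at M m e J P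
    = principal_hyperplanes M m P"
proof (intro equalityI subsetI)
  fix H assume "H \<in> principal_hyperplanes M m P"
  then obtain v l where v: "H = hyperplane_through P v" "v \<noteq> 0" "v \<in> eigenspace l"
    and l: "l \<in> confocal_params_at M m e J P"
    unfolding principal_hyperplanes_def principal_direction_iff by blast
  obtain c where "c \<noteq> 0" "v = c *\<^sub>R normal l"
    using eigenvectors_parallel[OF assms v(3) _ v(2)] normal_eigenvector[OF l] by metis
  then have "H = confocal_tangent M m e J l P"
    using v(1) by (simp add: tangent_eq hyperplane_through_scaleR)
  then show "H \<in> (\<lambda>\<mu>. confocal_tangent M m e J \<mu> P) ` confocal_params_at M m e J P"
    using l by blast
qed (use tangent_principal in auto)

lemma parallel_to_eigenbasis:
  assumes "focal_indices M m e J P = {}" "ordered_eigenbasis n" "principal_direction M m P v"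
  obtains j c where "j \<in> {1..CARD('k)}" "c \<noteq> 0" "v = c *\<^sub>R n j"
proof -
  obtain l where l: "l \<in> eigenvalues" "v \<in> eigenspace l" "v \<noteq> 0"
    using assms(3) unfolding principal_direction_iff params_eq_eigenvalues by blast
  then obtain j where j: "j \<in> {1..CARD('k)}" "l = n j \<bullet> inertia_op M m P (n j)"
    using eigenvalues_eq[OF assms(2)] by auto
  have "n j \<in> eigenspace l" "n j \<noteq> 0"
    using assms(2) j orthonormal_familyD[of n j j]
    by (auto simp: ordered_eigenbasis_def eigenspace_def)
  then show ?thesis
    using eigenvectors_parallel[OF assms(1) l(2) _ l(3)] j(1) that by metis
qed

lemma eigenbasis_principal_direction:
  assumes "ordered_eigenbasis n" "j \<in> {1..CARD('k)}"
  shows "principal_direction M m P (n j)"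
  using assms orthonormal_familyD[of n j j]
  unfolding ordered_eigenbasis_def principal_direction_def by auto

lemma bij_betw_principal_axes:
  assumes "focal_indices M m e J P = {}" and n: "ordered_eigenbasis n"
  shows "bij_betw (\<lambda>j. line_through P (n j)) {1..CARD('k)} (principal_axes M m P)"
proof (rule bij_betwI')
  have on: "orthonormal_family n" using n by (simp add: ordered_eigenbasis_def)
  show "line_through P (n i) = line_through P (n j) \<longleftrightarrow> i = j"
    if ij: "i \<in> {1..CARD('k)}" "j \<in> {1..CARD('k)}" for i j
  proof
    assume "line_through P (n i) = line_through P (n j)"
    then obtain t where "n i = t *\<^sub>R n j" using line_through_eqD by blast
    then show "i = j"
      using orthonormal_familyD[OF on, of i i] orthonormal_familyD[OF on, of i j] ij
      by (auto split: if_splits)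
  qed simp
  show "line_through P (n j) \<in> principal_axes M m P" if "j \<in> {1..CARD('k)}" for j
    unfolding principal_axes_def using eigenbasis_principal_direction[OF n that] by blast
  fix L assume "L \<in> principal_axes M m P"
  then obtain v where v: "L = line_through P v" "principal_direction M m P v"
    unfolding principal_axes_def by blast
  then show "\<exists>j\<in>{1..CARD('k)}. L = line_through P (n j)"
    using parallel_to_eigenbasis[OF assms(1) n v(2)] line_through_scaleR by metis
qed

lemma bij_betw_principal_hyperplanes:
  assumes "focal_indices M m e J P = {}" and n: "ordered_eigenbasis n"
  shows "bij_betw (\<lambda>j. hyperplane_through P (n j)) {1..CARD('k)} (principal_hyperplanes M m P)"
proof (rule bij_betwI')
  have on: "orthonormal_family n" using n by (simp add: ordered_eigenbasis_def)
  show "hyperplane_through P (n i) = hyperplane_through P (n j) \<longleftrightarrow> i = j"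
    if ij: "i \<in> {1..CARD('k)}" "j \<in> {1..CARD('k)}" for i j
  proof
    assume "hyperplane_through P (n i) = hyperplane_through P (n j)"
    from hyperplane_through_eqD[OF this] show "i = j"
      using orthonormal_familyD[OF on, of j j] orthonormal_familyD[OF on, of i j] ij
      by (auto split: if_splits)
  qed simp
  show "hyperplane_through P (n j) \<in> principal_hyperplanes M m P" if "j \<in> {1..CARD('k)}" for j
    unfolding principal_hyperplanes_def using eigenbasis_principal_direction[OF n that] by blast
  fix H assume "H \<in> principal_hyperplanes M m P"
  then obtain v where v: "H = hyperplane_through P v" "principal_direction M m P v"
    unfolding principal_hyperplanes_def by blast
  then show "\<exists>j\<in>{1..CARD('k)}. H = hyperplane_through P (n j)"
    using parallel_to_eigenbasis[OF assms(1) n v(2)] hyperplane_through_scaleR by metis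
qed

lemma restricted_pca_iff: "restricted_pca M m P n \<longleftrightarrow> ordered_eigenbasis n"
  unfolding restricted_pca_iff_successive_maximizers[OF positive_operator_axioms]
  by (rule successive_maximizers_iff)

text \<open>Orthonormal principal directions are described by the axes they span: a unit vector on a
  principal axis is a multiple of an eigenvector, hence itself one.\<close>

lemma ordered_eigenbasis_iff:
  "ordered_eigenbasis n \<longleftrightarrow>
    (\<forall>j\<in>{1..CARD('k)}. norm (n j) = 1 \<and> line_through P (n j) \<in> principal_axes M m P) \<and>
    (\<forall>i\<in>{1..CARD('k)}. \<forall>j\<in>{1..CARD('k)}. i \<noteq> j \<longrightarrow> n i \<bullet> n j = 0) \<and>
    (\<forall>i\<in>{1..CARD('k)}. \<forall>j\<in>{1..CARD('k)}. i \<le> j \<longrightarrow>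
       covariance M m P (n j) (n j) \<le> covariance M m P (n i) (n i))"
proof -
  have "orthonormal_family n \<longleftrightarrow> (\<forall>j\<in>{1..CARD('k)}. norm (n j) = 1) \<and>
      (\<forall>i\<in>{1..CARD('k)}. \<forall>j\<in>{1..CARD('k)}. i \<noteq> j \<longrightarrow> n i \<bullet> n j = 0)"
    unfolding orthonormal_family_def DIM_vec norm_eq_1 by (auto; metis)
  moreover have "inertia_op M m P v = (v \<bullet> inertia_op M m P v) *\<^sub>R v \<longleftrightarrow>
      line_through P v \<in> principal_axes M m P" if "norm v = 1" for v
  proof
    assume "inertia_op M m P v = (v \<bullet> inertia_op M m P v) *\<^sub>R v"
    then show "line_through P v \<in> principal_axes M m P"
      using that unfolding principal_axes_def principal_direction_def by fastforce
  next
    assume "line_through P v \<in> principal_axes M m P"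
    then obtain w l where w: "line_through P v = line_through P w" "w \<in> eigenspace l"
      unfolding principal_axes_def principal_direction_def eigenspace_def by blast
    obtain t where "v = t *\<^sub>R w" using line_through_eqD[OF w(1)] by blast
    then have "v \<in> eigenspace l" using subspace_eigenspace w(2) subspace_scale by blast
    then have "inertia_op M m P v = l *\<^sub>R v" by (simp add: eigenspace_def)
    then show "inertia_op M m P v = (v \<bullet> inertia_op M m P v) *\<^sub>R v"
      using that by (simp add: norm_eq_1)
  qed
  ultimately show ?thesis
    unfolding ordered_eigenbasis_def covariance_def DIM_vec by blast
qed

end

theorem theorem4p1:
  fixes M :: "'N::finite \<Rightarrow> real ^ 'k" and m :: "'N \<Rightarrow> real"
    and e :: "nat \<Rightarrow> real ^ 'k" and J :: "nat \<Rightarrow> real" and P :: "real ^ 'k"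
  assumes masses: "\<And>j. m j > 0"
    and not_in_hyperplane: "\<not> (\<exists>a b. a \<noteq> 0 \<and> (\<forall>j. a \<bullet> M j = b))"
    and principal: "central_principal_system M m e J"
    and J_pos: "0 < J 1"
    and J_increasing: "strict_mono_on {1..CARD('k)} J"
  shows
    "card (confocal_quadrics_at M m e J P) + card (focal_indices M m e J P) = CARD('k) \<and>
     (\<forall>\<mu>\<in>confocal_params_at M m e J P. \<forall>\<nu>\<in>confocal_params_at M m e J P.
        confocal_quadric M m e J \<mu> \<noteq> confocal_quadric M m e J \<nu> \<longrightarrow>
        orthogonal_hyperplanes (confocal_tangent M m e J \<mu> P) (confocal_tangent M m e J \<nu> P)) \<and>
     (\<forall>\<mu>\<in>confocal_params_at M m e J P.
        confocal_tangent M m e J \<mu> P \<in> principal_hyperplanes M m P) \<and>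
     (\<exists>n. restricted_pca M m P n) \<and>
     (\<forall>n. restricted_pca M m P n \<longleftrightarrow>
        (\<forall>j\<in>{1..CARD('k)}. norm (n j) = 1 \<and> line_through P (n j) \<in> principal_axes M m P) \<and>
        (\<forall>i\<in>{1..CARD('k)}. \<forall>j\<in>{1..CARD('k)}. i \<noteq> j \<longrightarrow> n i \<bullet> n j = 0) \<and>
        (\<forall>i\<in>{1..CARD('k)}. \<forall>j\<in>{1..CARD('k)}. i \<le> j \<longrightarrow>
           covariance M m P (n j) (n j) \<le> covariance M m P (n i) (n i))) \<and>
     (focal_indices M m e J P = {} \<longrightarrow>
        card (confocal_quadrics_at M m e J P) = CARD('k) \<and>
        (\<lambda>\<mu>. confocal_tangent M m e J \<mu> P) ` confocal_params_at M m e J P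
          = principal_hyperplanes M m P \<and>
        card (principal_hyperplanes M m P) = CARD('k) \<and>
        (\<forall>n. restricted_pca M m P n \<longrightarrow>
           bij_betw (\<lambda>j. line_through P (n j)) {1..CARD('k)} (principal_axes M m P) \<and>
           bij_betw (\<lambda>j. hyperplane_through P (n j)) {1..CARD('k)}
             ((\<lambda>\<mu>. confocal_tangent M m e J \<mu> P) ` confocal_params_at M m e J P)))"
proof -
  interpret confocal_pencil M m e J P
    using masses not_in_hyperplane principal strict_mono_on_imp_inj_on[OF J_increasing]
    by (rule confocal_pencil.intro)
  have count: "card (confocal_quadrics_at M m e J P) + card (focal_indices M m e J P) = CARD('k)"
    using card_params card_confocal_quadrics_at by simp
  have generic: "card (confocal_quadrics_at M m e J P) = CARD('k) \<and>
      (\<lambda>\<mu>. confocal_tangent M m e J \<mu> P) ` confocal_params_at M m e J P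
        = principal_hyperplanes M m P \<and>
      card (principal_hyperplanes M m P) = CARD('k) \<and>
      (\<forall>n. restricted_pca M m P n \<longrightarrow>
         bij_betw (\<lambda>j. line_through P (n j)) {1..CARD('k)} (principal_axes M m P) \<and>
         bij_betw (\<lambda>j. hyperplane_through P (n j)) {1..CARD('k)}
           ((\<lambda>\<mu>. confocal_tangent M m e J \<mu> P) ` confocal_params_at M m e J P))"
    if nonfocal: "focal_indices M m e J P = {}"
  proof -
    note hyperplanes = tangents_eq_principal_hyperplanes[OF nonfocal]
    have "card (principal_hyperplanes M m P) = card (confocal_params_at M m e J P)"
      unfolding hyperplanes[symmetric] by (rule card_image[OF tangent_inj])
    then show ?thesis
      using count card_confocal_quadrics_at nonfocal hyperplanes
        bij_betw_principal_axes[OF nonfocal] bij_betw_principal_hyperplanes[OF nonfocal]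
      by (simp add: restricted_pca_iff)
  qed
  show ?thesis
  proof (intro conjI)
    show "\<exists>n. restricted_pca M m P n"
      unfolding restricted_pca_iff successive_maximizers_iff[symmetric]
      by (rule successive_maximizers_exist)
    show "\<forall>n. restricted_pca M m P n \<longleftrightarrow>
        (\<forall>j\<in>{1..CARD('k)}. norm (n j) = 1 \<and> line_through P (n j) \<in> principal_axes M m P) \<and>
        (\<forall>i\<in>{1..CARD('k)}. \<forall>j\<in>{1..CARD('k)}. i \<noteq> j \<longrightarrow> n i \<bullet> n j = 0) \<and>
        (\<forall>i\<in>{1..CARD('k)}. \<forall>j\<in>{1..CARD('k)}. i \<le> j \<longrightarrow>
           covariance M m P (n j) (n j) \<le> covariance M m P (n i) (n i))"
      unfolding restricted_pca_iff ordered_eigenbasis_iff by blast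
  qed (use count generic tangents_orthogonal tangent_principal in blast)+
qed

end
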